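(* Let $G$ be a connected undirected graph with $n$ nodes, $m$ edges and incidence matrix $B=[\mathbf b_1,\dots,\mathbf b_m]\in\mathbb R^{n\times m}$. Let $\Omega=\{\boldsymbol\omega\in\mathbb R^n: C\boldsymbol\omega\le\mathbf d\}$ be nonempty, with $C\in\mathbb R^{p\times n}$, $\mathbf d\in\mathbb R^p$, let $f_{\mathcal E}:\mathbb R_+^m\to\mathbb R$ be convex, let $F_{\mathbf w}\subset\mathbb R_+^m$ be a closed convex set with $\lambda_2(L(\mathbf w))>0$ for all $\mathbf w\in F_{\mathbf w}$, and let $\gamma_d\in[0,\pi/2)$. Then the robust weight design problem $$\underset{\mathbf w\in F_{\mathbf w}}{\text{minimize}}\ f_{\mathcal E}(\mathbf w)\quad\text{s.t.}\quad\max_{\boldsymbol\omega\in\Omega}\|B^\top L(\mathbf w)^\dagger\boldsymbol\omega\|_\infty\le\sin(\gamma_d)$$ is equivalent to the problem, with variables $\mathbf w\in F_{\mathbf w}$ and $\boldsymbol\lambda_e,\boldsymbol\gamma_e\in\mathbb R_+^p$ for $e\in\{1,\dots,m\}$, $$\begin{aligned}\min\ & f_{\mathcal E}(\mathbf w)\\ \text{s.t. for all } e\in\{1,\dots,m\}:\ & C^\top\boldsymbol\lambda_e-L(\mathbf w)^\dagger\mathbf b_e=\mathbf 0_n,\quad C^\top\boldsymbol\gamma_e+L(\mathbf w)^\dagger\mathbf b_e=\mathbf 0_n,\\ &\boldsymbol\lambda_e^\top\mathbf d\le\sin(\gamma_d),\quad \boldsymbol\gamma_e^\top\mathbf d\le\sin(\gamma_d),\quad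 \boldsymbol\lambda_e,\boldsymbol\gamma_e\ge 0,\end{aligned}$$ in the sense that $\mathbf w\in F_{\mathbf w}$ is feasible for the first problem if and only if there exist $\boldsymbol\lambda_e,\boldsymbol\gamma_e$, $e\in\{1,\dots,m\}$, such that $(\mathbf w,(\boldsymbol\lambda_e)_e,(\boldsymbol\gamma_e)_e)$ is feasible for the second (so, the objectives being identical, the two problems have the same optimal value and the same optimal $\mathbf w$).
   Context: The incidence matrix $B$ has, for each edge $e=\{i,j\}$, a column $\mathbf b_e\in\mathbb R^n$ with $b_{e,i}=1$, $b_{e,j}=-1$ (or the opposite signs; the orientation is arbitrary) and all other entries zero. The weighted Laplacian is $L(\mathbf w)=B\,\mathrm{diag}(\mathbf w)B^\top$; $\lambda_2(L(\mathbf w))$ is its second smallest eigenvalue; $(\cdot)^\dagger$ is the Moore-Penrose pseudoinverse. $\|\mathbf x\|_\infty=\max_i|x_i|$, and inequalities between vectors are componentwise. The constraint $\max_{\boldsymbol\omega\in\Omega}\|B^\top L(\mathbf w)^\dagger\boldsymbol\omega\|_\infty\le\sin(\gamma_d)$ means that $\|B^\top L(\mathbf w)^\dagger\boldsymbol\omega\|_\infty\le\sin(\gamma_d)$ for every $\boldsymbol\omega\in\Omega$. *)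

theory Defs
  imports "HOL-Analysis.Analysis" "HOL-Computational_Algebra.Polynomial"
begin

section \<open>Matrices\<close>

text \<open>In HOL-Analysis the type \<open>real ^ 'n ^ 'm\<close> is that of matrices with rows indexed by
  \<open>'m\<close> and columns indexed by \<open>'n\<close>; the order on vectors is componentwise, and \<open>infnorm\<close> is the
  maximum norm.\<close>

definition diag :: "real ^ 'n \<Rightarrow> real ^ 'n ^ 'n" where
  "diag v = (\<chi> i j. if i = j then v $ i else 0)"

definition charpoly :: "real ^ 'n ^ 'n \<Rightarrow> real poly" where
  "charpoly A = det (mat [:0, 1:] - (\<chi> i j. [:A $ i $ j:]))"

text \<open>Eigenvalues are counted with multiplicity. The value is meaningful only if \<open>A\<close> has at
  least two real eigenvalues, e.g. for symmetric matrices of size at least 2.\<close>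

definition second_smallest_eigenvalue :: "real ^ 'n ^ 'n \<Rightarrow> real" where
  "second_smallest_eigenvalue A = sorted_list_of_multiset (proots (charpoly A)) ! 1"

text \<open>The four Penrose conditions.\<close>

definition is_pinv :: "real ^ 'n ^ 'm \<Rightarrow> real ^ 'm ^ 'n \<Rightarrow> bool" where
  "is_pinv A X \<longleftrightarrow>
     A ** X ** A = A \<and>
     X ** A ** X = X \<and>
     transpose (A ** X) = A ** X \<and>
     transpose (X ** A) = X ** A"

definition pinv :: "real ^ 'n ^ 'm \<Rightarrow> real ^ 'm ^ 'n" where
  "pinv A = (THE X. is_pinv A X)"


section \<open>Graphs\<close>

text \<open>A simple undirected graph on the vertex set \<open>UNIV :: 'n set\<close> is given by its set of edges,
  which are two-element sets of vertices.\<close>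

definition simple_graph :: "'n set set \<Rightarrow> bool" where
  "simple_graph E \<longleftrightarrow> (\<forall>e\<in>E. card e = 2)"

definition connected_graph :: "'n set set \<Rightarrow> bool" where
  "connected_graph E \<longleftrightarrow> (\<forall>u v. (u, v) \<in> {(a, b). {a, b} \<in> E}\<^sup>*)"

text \<open>An enumeration of the edges by the index type \<open>'m\<close>, each edge once, with an arbitrary
  orientation: edge number \<open>e\<close> is \<open>{s e, t e}\<close>.\<close>

definition oriented_enumeration :: "'n set set \<Rightarrow> ('m \<Rightarrow> 'n) \<Rightarrow> ('m \<Rightarrow> 'n) \<Rightarrow> bool" where
  "oriented_enumeration E s t \<longleftrightarrow> bij_betw (\<lambda>e. {s e, t e}) UNIV E"

definition incidence_matrix :: "('m \<Rightarrow> 'n) \<Rightarrow> ('m \<Rightarrow> 'n) \<Rightarrow> real ^ 'm ^ 'n" where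
  "incidence_matrix s t = (\<chi> i e. if i = s e then 1 else if i = t e then -1 else 0)"

definition laplacian :: "real ^ 'm ^ 'n \<Rightarrow> real ^ 'm \<Rightarrow> real ^ 'n ^ 'n" where
  "laplacian B w = B ** diag w ** transpose B"


section \<open>The two optimization problems\<close>

definition uncertainty_set :: "real ^ 'n ^ 'p \<Rightarrow> real ^ 'p \<Rightarrow> (real ^ 'n) set" where
  "uncertainty_set C d = {\<omega>. C *v \<omega> \<le> d}"

text \<open>The maximum over a possibly unbounded set is bounded by \<open>sin \<gamma>\<^sub>d\<close> when every
  member of the set satisfies the bound.\<close>

definition robust_feasible ::
  "real ^ 'm ^ 'n \<Rightarrow> real ^ 'n ^ 'p \<Rightarrow> real ^ 'p \<Rightarrow> real \<Rightarrow> (real ^ 'm) set \<Rightarrow> (real ^ 'm) set" where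
  "robust_feasible B C d \<gamma>\<^sub>d Fw =
     {w \<in> Fw. \<forall>\<omega> \<in> uncertainty_set C d.
        infnorm (transpose B *v (pinv (laplacian B w) *v \<omega>)) \<le> sin \<gamma>\<^sub>d}"

definition dual_feasible ::
  "real ^ 'm ^ 'n \<Rightarrow> real ^ 'n ^ 'p \<Rightarrow> real ^ 'p \<Rightarrow> real \<Rightarrow> (real ^ 'm) set \<Rightarrow>
   ((real ^ 'm) \<times> ('m \<Rightarrow> (real ^ 'p)) \<times> ('m \<Rightarrow> (real ^ 'p))) set" where
  "dual_feasible B C d \<gamma>\<^sub>d Fw =
     {(w, l, g). w \<in> Fw \<and>
        (\<forall>e. transpose C *v l e - pinv (laplacian B w) *v column e B = 0 \<and>
             transpose C *v g e + pinv (laplacian B w) *v column e B = 0 \<and>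
             l e \<bullet> d \<le> sin \<gamma>\<^sub>d \<and> g e \<bullet> d \<le> sin \<gamma>\<^sub>d \<and>
             0 \<le> l e \<and> 0 \<le> g e)}"

end

theory Submission
  imports Defs
begin

text \<open>For each edge \<open>e\<close>, symmetry of \<open>L\<^sup>\<dagger>\<close> gives \<open>(B\<^sup>T L\<^sup>\<dagger> \<omega>)\<^sub>e = (L\<^sup>\<dagger> b\<^sub>e) \<bullet> \<omega>\<close>, so the
  robust constraint says that the linear inequalities \<open>\<plusminus>(L\<^sup>\<dagger> b\<^sub>e) \<bullet> \<omega> \<le> sin \<gamma>\<^sub>d\<close> are consequences of
  the consistent system \<open>C \<omega> \<le> d\<close>. By the affine form of Farkas' lemma this holds iff each of them is
  implied by a nonnegative combination of the rows of the system; the coefficients are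
  \<open>\<lambda>\<^sub>e\<close> and \<open>\<gamma>\<^sub>e\<close>.\<close>

section \<open>Affine Farkas lemma\<close>

text \<open>Weak duality gives one direction. For the other, \<open>(a, \<beta>)\<close> is
  separated from the cone generated by \<open>(0, 1)\<close> and the pairs
  \<open>(C $ i, d $ i)\<close>. A separating functional \<open>(y, \<tau>)\<close> would produce a
  solution of \<open>C *v x \<le> d\<close> that violates the bound: the point
  \<open>- y / \<tau>\<close> if \<open>\<tau> > 0\<close>, a point far along the direction
  \<open>- y\<close> if \<open>\<tau> = 0\<close>.\<close>

lemma affine_farkas:
  fixes C :: "real ^ 'n ^ 'p" and d :: "real ^ 'p" and a :: "real ^ 'n"
  assumes ne: "{x. C *v x \<le> d} \<noteq> {}"
  shows "(\<forall>x. C *v x \<le> d \<longrightarrow> a \<bullet> x \<le> \<beta>) \<longleftrightarrow>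
         (\<exists>l. 0 \<le> l \<and> transpose C *v l = a \<and> l \<bullet> d \<le> \<beta>)"
proof
  assume "\<exists>l. 0 \<le> l \<and> transpose C *v l = a \<and> l \<bullet> d \<le> \<beta>"
  then obtain l where l: "0 \<le> l" "transpose C *v l = a" "l \<bullet> d \<le> \<beta>"
    by blast
  show "\<forall>x. C *v x \<le> d \<longrightarrow> a \<bullet> x \<le> \<beta>"
  proof (intro allI impI)
    fix x assume x: "C *v x \<le> d"
    have "a \<bullet> x = l \<bullet> (C *v x)"
      using l(2) by (simp flip: dot_lmul_matrix)
    also have "\<dots> \<le> l \<bullet> d"
      using l(1) x by (auto simp: inner_vec_def less_eq_vec_def intro!: sum_mono mult_left_mono)
    finally show "a \<bullet> x \<le> \<beta>" using l(3) by simp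
  qed
next
  assume bound: "\<forall>x. C *v x \<le> d \<longrightarrow> a \<bullet> x \<le> \<beta>"
  \<comment> \<open>The generator \<open>(0, 1)\<close> provides the slack that turns
    \<open>l \<bullet> d = \<beta>\<close> into \<open>l \<bullet> d \<le> \<beta>\<close>. Since
    \<open>G\<close> is finite, its conic hull \<open>K\<close> is closed, as strict separation
    requires; \<open>T\<close> makes the multipliers explicit, and the inclusion
    \<open>K \<subseteq> T\<close> suffices to read them off.\<close>
  define G where "G = insert (0, 1) (range (\<lambda>i. (C $ i, d $ i)))"
  define K where "K = convex_cone hull G"
  define T where "T = {(transpose C *v l, l \<bullet> d + \<mu>) | l \<mu>. 0 \<le> l \<and> (0::real) \<le> \<mu>}"
  have "convex_cone T"
    unfolding convex_cone_iff
  proof (intro conjI ballI allI impI)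
    show "0 \<in> T"
      unfolding T_def by (auto simp: zero_prod_def intro!: exI[of _ 0])
  next
    fix x y assume "x \<in> T" "y \<in> T"
    then obtain l \<mu> k \<nu> where
      "x = (transpose C *v l, l \<bullet> d + \<mu>)" "0 \<le> l" "0 \<le> \<mu>"
      "y = (transpose C *v k, k \<bullet> d + \<nu>)" "0 \<le> k" "0 \<le> \<nu>"
      unfolding T_def by blast
    then show "x + y \<in> T"
      unfolding T_def
      by (auto simp: vector_matrix_left_distrib inner_add_left less_eq_vec_def
          intro!: exI[of _ "l + k"] exI[of _ "\<mu> + \<nu>"])
  next
    fix x and c :: real assume "x \<in> T" "0 \<le> c"
    then obtain l \<mu> where
      "x = (transpose C *v l, l \<bullet> d + \<mu>)" "0 \<le> l" "0 \<le> \<mu>"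
      unfolding T_def by blast
    with \<open>0 \<le> c\<close> show "c *\<^sub>R x \<in> T"
      unfolding T_def
      by (auto simp: scaleR_vector_matrix_assoc less_eq_vec_def algebra_simps
          intro!: exI[of _ "c *\<^sub>R l"] exI[of _ "c * \<mu>"])
  qed
  moreover have "G \<subseteq> T"
  proof -
    have "(0, 1) \<in> T"
      unfolding T_def by (auto intro!: exI[of _ "0 :: real ^ 'p"] exI[of _ "1 :: real"])
    moreover have "(C $ i, d $ i) \<in> T" for i
    proof -
      have "transpose C *v axis i 1 = C $ i"
        unfolding matrix_vector_mult_basis column_transpose by (simp add: row_def)
      moreover have "0 \<le> axis i (1 :: real)"
        by (simp add: less_eq_vec_def axis_def)
      ultimately show ?thesis
        unfolding T_def
        by (intro CollectI exI[of _ "axis i 1"] exI[of _ "0 :: real"]) (simp add: inner_axis')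
    qed
    ultimately show ?thesis unfolding G_def by blast
  qed
  ultimately have KT: "K \<subseteq> T"
    unfolding K_def by (rule hull_minimal[rotated])
  have "(a, \<beta>) \<in> K"
  proof (rule ccontr)
    assume "(a, \<beta>) \<notin> K"
    moreover have "convex K" "closed K"
      unfolding K_def G_def by (auto intro!: convex_convex_cone_hull closed_convex_cone_hull)
    ultimately obtain h b where "h \<bullet> (a, \<beta>) < b" and Kb: "\<And>x. x \<in> K \<Longrightarrow> b < h \<bullet> x"
      using separating_hyperplane_closed_point by metis
    moreover have "b < 0"
      using Kb[of 0] unfolding K_def by (simp add: convex_cone_hull_contains_0)
    ultimately have neg: "h \<bullet> (a, \<beta>) < 0" by simp
    \<comment> \<open>A generator with \<open>h \<bullet> x < 0\<close> could be scaled by the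
      nonnegative factor \<open>b / (h \<bullet> x)\<close> to a point of the cone where
      \<open>h\<close> takes the value \<open>b\<close> exactly, against the strict
      separation.\<close>
    have nonneg: "0 \<le> h \<bullet> x" if "x \<in> G" for x
    proof (rule ccontr)
      assume "\<not> 0 \<le> h \<bullet> x"
      then have "(b / (h \<bullet> x)) *\<^sub>R x \<in> K"
        using that \<open>b < 0\<close> unfolding K_def
        by (intro convex_cone_hull_mul hull_inc divide_nonpos_nonpos) auto
      from Kb[OF this] \<open>\<not> 0 \<le> h \<bullet> x\<close> show False by simp
    qed
    obtain y \<tau> where h: "h = (y, \<tau>)" by fastforce
    have neg': "y \<bullet> a + \<tau> * \<beta> < 0" using neg h by simp
    have "0 \<le> \<tau>" using nonneg[of "(0, 1)"] h by (simp add: G_def)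
    have Cy: "0 \<le> (C *v y) $ i + \<tau> * d $ i" for i
      using nonneg[of "(C $ i, d $ i)"] h
      by (simp add: G_def matrix_vector_mul_component inner_commute)
    show False
    proof (cases "\<tau> = 0")
      case False
      with \<open>0 \<le> \<tau>\<close> have "0 < \<tau>" by simp
      \<comment> \<open>Dividing \<open>Cy\<close> by \<open>\<tau>\<close> shows that
        \<open>- y / \<tau>\<close> solves the system, while \<open>neg'\<close> divided by
        \<open>\<tau>\<close> says that \<open>a\<close> exceeds \<open>\<beta>\<close>
        there.\<close>
      have "C *v ((- 1 / \<tau>) *\<^sub>R y) \<le> d"
        unfolding less_eq_vec_def
      proof
        fix i
        show "(C *v ((- 1 / \<tau>) *\<^sub>R y)) $ i \<le> d $ i"
          using Cy[of i] \<open>0 < \<tau>\<close> unfolding matrix_vector_mult_scaleR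
          by (simp add: field_simps)
      qed
      with bound have "a \<bullet> ((- 1 / \<tau>) *\<^sub>R y) \<le> \<beta>" by blast
      with neg' \<open>0 < \<tau>\<close> show False by (simp add: field_simps inner_commute)
    next
      case True
      obtain x where x: "C *v x \<le> d" using ne by blast
      \<comment> \<open>With \<open>\<tau> = 0\<close>, \<open>Cy\<close> makes \<open>- y\<close> a
        recession direction of the polyhedron, and \<open>a\<close> grows along it. The step
        \<open>r\<close> is chosen so that \<open>a\<close> takes the value \<open>a \<bullet> x +
        \<bar>\<beta> - a \<bullet> x\<bar> + 1 > \<beta>\<close> at
        \<open>x - r *\<^sub>R y\<close>. Consistency of the system supplies the starting point
        \<open>x\<close>.\<close>
      define r where "r = (\<bar>\<beta> - a \<bullet> x\<bar> + 1) / (- (a \<bullet> y))"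
      have "a \<bullet> y < 0" using neg' True by (simp add: inner_commute)
      then have "0 \<le> r" by (simp add: r_def divide_nonneg_neg)
      then have "C *v (x - r *\<^sub>R y) \<le> d"
        using x Cy True
        by (auto simp: less_eq_vec_def matrix_vector_mult_diff_distrib matrix_vector_mult_scaleR
            intro: order_trans[rotated])
      with bound have "a \<bullet> (x - r *\<^sub>R y) \<le> \<beta>" by blast
      moreover have "r * (a \<bullet> y) = - (\<bar>\<beta> - a \<bullet> x\<bar> + 1)"
        using \<open>a \<bullet> y < 0\<close> by (simp add: r_def)
      ultimately show False by (simp add: inner_diff_right)
    qed
  qed
  with KT have "(a, \<beta>) \<in> T" by blast
  then show "\<exists>l. 0 \<le> l \<and> transpose C *v l = a \<and> l \<bullet> d \<le> \<beta>"
    unfolding T_def by auto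
qed

section \<open>Pseudoinverse of a symmetric matrix\<close>

text \<open>\<open>A ** X\<close> and \<open>A ** Y\<close> are both the orthogonal projection onto
  the range of \<open>A\<close>, hence equal; likewise \<open>X ** A = Y ** A\<close>. Then
  \<open>X = X ** A ** X = X ** A ** Y = Y ** A ** Y = Y\<close>.\<close>

lemma is_pinv_unique:
  assumes "is_pinv A X" "is_pinv A Y"
  shows "X = Y"
proof -
  have "X = X ** (A ** X)"
    using assms by (simp add: is_pinv_def matrix_mul_assoc)
  also have "A ** X = A ** Y"
  proof -
    have "A ** X = transpose (A ** Y ** (A ** X))"
      using assms by (simp add: is_pinv_def matrix_mul_assoc)
    also have "\<dots> = A ** X ** (A ** Y)"
      using assms by (simp add: is_pinv_def matrix_transpose_mul)
    also have "\<dots> = A ** Y"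
      using assms by (simp add: is_pinv_def matrix_mul_assoc)
    finally show ?thesis .
  qed
  also have "X ** (A ** Y) = X ** A ** Y"
    by (simp add: matrix_mul_assoc)
  also have "X ** A = Y ** A"
  proof -
    have "X ** A = transpose (X ** A ** (Y ** A))"
      using assms by (simp add: is_pinv_def flip: matrix_mul_assoc)
    also have "\<dots> = Y ** A ** (X ** A)"
      using assms by (simp add: is_pinv_def matrix_transpose_mul)
    also have "\<dots> = Y ** A"
      using assms by (simp add: is_pinv_def flip: matrix_mul_assoc)
    finally show ?thesis .
  qed
  also have "Y ** A ** Y = Y"
    using assms by (simp add: is_pinv_def)
  finally show ?thesis .
qed

lemma pinv_eqI: "is_pinv A X \<Longrightarrow> pinv A = X"
  unfolding pinv_def by (blast intro: the_equality is_pinv_unique)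

lemma ex_orthogonal_projection_matrix:
  fixes S :: "(real ^ 'n) set"
  assumes "subspace S"
  obtains P :: "real ^ 'n ^ 'n"
  where "transpose P = P" "\<And>x. P *v x \<in> S" "\<And>x. x \<in> S \<Longrightarrow> P *v x = x"
proof -
  obtain b where b: "b \<subseteq> S" "pairwise orthogonal b" "\<And>x. x \<in> b \<Longrightarrow> norm x = 1"
    "independent b" "span b = S"
    using orthonormal_basis_subspace[OF assms] by metis
  have fin: "finite b" using b(4) by (rule independent_imp_finite)
  \<comment> \<open>The sum of the rank-one matrices \<open>v v^T\<close> over an orthonormal basis
    of \<open>S\<close>.\<close>
  define P :: "real ^ 'n ^ 'n" where "P = (\<chi> i j. \<Sum>v\<in>b. v $ i * v $ j)"
  have P: "P *v x = (\<Sum>v\<in>b. (v \<bullet> x) *\<^sub>R v)" for x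
  proof -
    have "(P *v x) $ i = (\<Sum>v\<in>b. (v \<bullet> x) *\<^sub>R v) $ i" for i
    proof -
      have "(P *v x) $ i = (\<Sum>j\<in>UNIV. \<Sum>v\<in>b. v $ i * v $ j * x $ j)"
        by (simp add: P_def matrix_vector_mult_def sum_distrib_right)
      also have "\<dots> = (\<Sum>v\<in>b. \<Sum>j\<in>UNIV. v $ i * v $ j * x $ j)"
        by (rule sum.swap)
      also have "\<dots> = (\<Sum>v\<in>b. (v \<bullet> x) *\<^sub>R v) $ i"
        by (simp add: inner_vec_def sum_distrib_left mult_ac)
      finally show ?thesis .
    qed
    then show ?thesis by (simp add: vec_eq_iff)
  qed
  show thesis
  proof
    show "transpose P = P"
      by (simp add: P_def transpose_def vec_eq_iff mult.commute)
    show "P *v x \<in> S" for x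
      unfolding P using b(1) assms by (auto intro!: subspace_sum subspace_scale)
    show "P *v x = x" if "x \<in> S" for x
      unfolding P using orthonormal_basis_expand[OF b(2,3)] that b(5) fin by (simp add: inner_commute[of _ x])
  qed
qed

lemma matrix_add_mult_distrib: "(A + B) ** C = A ** C + B ** (C :: 'a::semiring_1 ^ 'n ^ 'k)"
  by (simp add: matrix_matrix_mult_def vec_eq_iff sum.distrib distrib_right)

lemma matrix_diff_mult_distrib: "(A - B) ** C = A ** C - B ** (C :: 'a::ring_1 ^ 'n ^ 'k)"
  by (simp add: matrix_matrix_mult_def vec_eq_iff sum_subtractf left_diff_distrib)

lemma matrix_mult_diff_distrib: "A ** (B - C) = A ** B - A ** (C :: 'a::ring_1 ^ 'n ^ 'k)"
  by (simp add: matrix_matrix_mult_def vec_eq_iff sum_subtractf right_diff_distrib)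

lemma transpose_diff: "transpose (A - B) = transpose A - transpose B"
  by (simp add: transpose_def vec_eq_iff)

text \<open>With \<open>P\<close> the orthogonal projection onto the kernel, \<open>A + P\<close> is invertible and the
  pseudoinverse of \<open>A\<close> is \<open>(A + P)\<^sup>-\<^sup>1 - P\<close>.\<close>

lemma ex_is_pinv_symmetric:
  fixes A :: "real ^ 'n ^ 'n"
  assumes sym: "transpose A = A"
  shows "\<exists>X. is_pinv A X"
proof -
  have "subspace {x. A *v x = 0}"
    by (auto simp: subspace_def matrix_vector_right_distrib matrix_vector_mult_scaleR)
  then obtain P :: "real ^ 'n ^ 'n" where P: "transpose P = P"
    "\<And>x. A *v (P *v x) = 0" "\<And>x. A *v x = 0 \<Longrightarrow> P *v x = x"
    by (rule ex_orthogonal_projection_matrix) auto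
  have AP: "A ** P = 0"
    using P(2) by (simp add: matrix_eq flip: matrix_vector_mul_assoc)
  have PA: "P ** A = 0"
    using AP P(1) sym matrix_transpose_mul[of A P]
    by (simp add: transpose_def vec_eq_iff zero_vec_def)
  have PP: "P ** P = P"
    using P(2,3) by (simp add: matrix_eq flip: matrix_vector_mul_assoc)
  \<comment> \<open>Applying \<open>P\<close> to \<open>(A + P) *v x = 0\<close> isolates
    \<open>P *v x = 0\<close>. Then \<open>A *v x = 0\<close> as well, so \<open>x\<close> lies in
    the kernel, where \<open>P\<close> is the identity.\<close>
  have "x = 0" if "(A + P) *v x = 0" for x
  proof -
    have "P *v x = P *v ((A + P) *v x)"
      by (simp add: matrix_vector_mul_assoc matrix_add_ldistrib PA PP)
    then have "P *v x = 0" using that by simp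
    then have "A *v x = 0"
      using that by (simp add: matrix_vector_mult_add_rdistrib)
    then show "x = 0" using P(3) \<open>P *v x = 0\<close> by simp
  qed
  then obtain M where MA: "M ** (A + P) = mat 1"
    using matrix_left_invertible_ker by blast
  then have AM: "(A + P) ** M = mat 1"
    by (simp add: matrix_left_right_inverse)
  have MP: "M ** P = P"
  proof -
    have "M ** P = M ** ((A + P) ** P)"
      by (simp add: matrix_add_mult_distrib AP PP)
    then show ?thesis by (simp add: matrix_mul_assoc MA)
  qed
  have PM: "P ** M = P"
  proof -
    have "P ** M = P ** (A + P) ** M"
      by (simp add: matrix_add_ldistrib PA PP)
    then show ?thesis by (simp add: AM flip: matrix_mul_assoc)
  qed
  \<comment> \<open>Both products with \<open>M - P\<close> equal the symmetric matrix
    \<open>mat 1 - P\<close>, which settles the two symmetry conditions of Penrose at once.\<close>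
  have AX: "A ** (M - P) = mat 1 - P"
    using AM by (simp add: matrix_mult_diff_distrib matrix_add_mult_distrib AP PM algebra_simps)
  have XA: "(M - P) ** A = mat 1 - P"
    using MA by (simp add: matrix_diff_mult_distrib matrix_add_ldistrib PA MP algebra_simps)
  have "is_pinv A (M - P)"
    unfolding is_pinv_def AX XA
    by (simp add: matrix_diff_mult_distrib matrix_mult_diff_distrib PA PM PP P(1) transpose_diff)
  then show ?thesis by blast
qed

text \<open>Transposing the Penrose conditions of a symmetric \<open>A\<close> shows that
  \<open>transpose X\<close> satisfies them along with \<open>X\<close>, so uniqueness applies.
  Existence must come first because \<open>pinv\<close> is a definite description.\<close>

lemma transpose_pinv_symmetric:
  fixes A :: "real ^ 'n ^ 'n"
  assumes "transpose A = A"
  shows "transpose (pinv A) = pinv A"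
proof -
  obtain X where X: "is_pinv A X"
    using ex_is_pinv_symmetric[OF assms] by blast
  then have "is_pinv A (transpose X)"
    unfolding is_pinv_def by (metis assms matrix_transpose_mul matrix_mul_assoc transpose_transpose)
  with X show ?thesis by (metis pinv_eqI)
qed

section \<open>Laplacian and the robust constraint\<close>

lemma transpose_laplacian: "transpose (laplacian B w) = laplacian B w"
proof -
  have "transpose (diag w) = diag w"
    by (simp add: diag_def transpose_def vec_eq_iff)
  then show ?thesis
    by (simp add: laplacian_def matrix_transpose_mul matrix_mul_assoc)
qed

lemma infnorm_le_iff_cart:
  fixes x :: "real ^ 'n"
  shows "infnorm x \<le> c \<longleftrightarrow> (\<forall>i. \<bar>x $ i\<bar> \<le> c)"
proof
  assume "infnorm x \<le> c"
  then show "\<forall>i. \<bar>x $ i\<bar> \<le> c"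
    using component_le_infnorm_cart order_trans by blast
next
  assume "\<forall>i. \<bar>x $ i\<bar> \<le> c"
  then show "infnorm x \<le> c"
    unfolding infnorm_cart by (intro cSup_least) auto
qed

lemma robust_iff_dual_feasible:
  fixes C :: "real ^ 'n ^ 'p" and B :: "real ^ 'm ^ 'n"
  assumes ne: "uncertainty_set C d \<noteq> {}"
  shows "w \<in> robust_feasible B C d \<gamma>\<^sub>d Fw \<longleftrightarrow> (\<exists>l g. (w, l, g) \<in> dual_feasible B C d \<gamma>\<^sub>d Fw)"
proof -
  define q where "q = (\<lambda>e. pinv (laplacian B w) *v column e B)"
  have nth: "(transpose B *v (pinv (laplacian B w) *v \<omega>)) $ e = q e \<bullet> \<omega>" for \<omega> e
  proof -
    have "(transpose B *v (pinv (laplacian B w) *v \<omega>)) $ e =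
        column e B \<bullet> (pinv (laplacian B w) *v \<omega>)"
      by (simp add: matrix_vector_mul_component transpose_def column_def)
    also have "\<dots> = (transpose (pinv (laplacian B w)) *v column e B) \<bullet> \<omega>"
      by (simp flip: dot_lmul_matrix)
    finally show ?thesis
      by (simp add: q_def transpose_pinv_symmetric transpose_laplacian)
  qed
  have farkas: "(\<forall>\<omega>\<in>uncertainty_set C d. a \<bullet> \<omega> \<le> sin \<gamma>\<^sub>d) \<longleftrightarrow>
      (\<exists>l. 0 \<le> l \<and> transpose C *v l = a \<and> l \<bullet> d \<le> sin \<gamma>\<^sub>d)" for a
    using affine_farkas[of C d a "sin \<gamma>\<^sub>d"] ne by (simp add: uncertainty_set_def)
  have "w \<in> robust_feasible B C d \<gamma>\<^sub>d Fw \<longleftrightarrow> w \<in> Fw \<and>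
      (\<forall>e. (\<forall>\<omega>\<in>uncertainty_set C d. q e \<bullet> \<omega> \<le> sin \<gamma>\<^sub>d) \<and>
           (\<forall>\<omega>\<in>uncertainty_set C d. (- q e) \<bullet> \<omega> \<le> sin \<gamma>\<^sub>d))"
    by (simp only: robust_feasible_def infnorm_le_iff_cart nth abs_le_iff inner_minus_left
        mem_Collect_eq) blast
  \<comment> \<open>Farkas' lemma is applied to \<open>q e\<close> and \<open>- q e\<close>, the two
    sides of the absolute value; choice gathers the multipliers of the single edges into the
    functions \<open>l\<close> and \<open>g\<close>.\<close>
  also have "\<dots> \<longleftrightarrow> w \<in> Fw \<and>
      (\<exists>l. \<forall>e. 0 \<le> l e \<and> transpose C *v l e = q e \<and> l e \<bullet> d \<le> sin \<gamma>\<^sub>d) \<and>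
      (\<exists>g. \<forall>e. 0 \<le> g e \<and> transpose C *v g e = - q e \<and> g e \<bullet> d \<le> sin \<gamma>\<^sub>d)"
    unfolding farkas all_conj_distrib choice_iff ..
  also have "\<dots> \<longleftrightarrow> (\<exists>l g. (w, l, g) \<in> dual_feasible B C d \<gamma>\<^sub>d Fw)"
    unfolding dual_feasible_def q_def by (auto simp: eq_neg_iff_add_eq_0)
  finally show ?thesis .
qed

theorem theorem4p1:
  fixes E :: "'n::finite set set"
    and s t :: "'m::finite \<Rightarrow> 'n"
    and B :: "real ^ 'm ^ 'n"
    and C :: "real ^ 'n ^ 'p::finite"
    and d :: "real ^ 'p"
    and f :: "real ^ 'm \<Rightarrow> real"
    and Fw :: "(real ^ 'm) set"
    and \<gamma>\<^sub>d :: real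
  assumes "simple_graph E" and "connected_graph E"
    and "oriented_enumeration E s t"
    and "B = incidence_matrix s t"
    and "uncertainty_set C d \<noteq> {}"
    and "convex_on {w. 0 \<le> w} f"
    and "Fw \<subseteq> {w. 0 \<le> w}" and "closed Fw" and "convex Fw"
    and "\<forall>w\<in>Fw. second_smallest_eigenvalue (laplacian B w) > 0"
    and "0 \<le> \<gamma>\<^sub>d" and "\<gamma>\<^sub>d < pi / 2"
  shows "(\<forall>w\<in>Fw. w \<in> robust_feasible B C d \<gamma>\<^sub>d Fw \<longleftrightarrow>
              (\<exists>l g. (w, l, g) \<in> dual_feasible B C d \<gamma>\<^sub>d Fw)) \<and>
         (INF w \<in> robust_feasible B C d \<gamma>\<^sub>d Fw. ereal (f w)) =
           (INF (w, l, g) \<in> dual_feasible B C d \<gamma>\<^sub>d Fw. ereal (f w)) \<and>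
         (\<forall>w. is_arg_min f (\<lambda>w. w \<in> robust_feasible B C d \<gamma>\<^sub>d Fw) w \<longleftrightarrow>
              (\<exists>l g. is_arg_min (\<lambda>(w, l, g). f w)
                       (\<lambda>x. x \<in> dual_feasible B C d \<gamma>\<^sub>d Fw) (w, l, g)))"
proof -
  let ?R = "robust_feasible B C d \<gamma>\<^sub>d Fw" and ?D = "dual_feasible B C d \<gamma>\<^sub>d Fw"
  have iff: "w \<in> ?R \<longleftrightarrow> (\<exists>l g. (w, l, g) \<in> ?D)" for w
    using \<open>uncertainty_set C d \<noteq> {}\<close> by (rule robust_iff_dual_feasible)
  \<comment> \<open>The feasible set of the first problem is the projection of that of the second,
    and the objective depends on \<open>w\<close> alone. Both infima are thus over the same set of
    values, also when it is empty or unbounded below.\<close>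
  then have "?R = fst ` ?D" by force
  then have "(INF w \<in> ?R. ereal (f w)) = (INF (w, l, g) \<in> ?D. ereal (f w))"
    by (simp add: image_image case_prod_unfold)
  moreover have "is_arg_min f (\<lambda>w. w \<in> ?R) w \<longleftrightarrow>
      (\<exists>l g. is_arg_min (\<lambda>(w, l, g). f w) (\<lambda>x. x \<in> ?D) (w, l, g))" for w
    unfolding is_arg_min_def iff by auto
  ultimately show ?thesis using iff by blast
qed

end
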